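(* Let $s\ge 1$. Then $(\Sigma^{s},\otimes)$ is a signed-semigroup and a signed-monoid, and $(\Sigma^{s}\setminus\{{}^{0}0\},\otimes)$ is a $1$i-loop, a signed-semigroup, a signed-monoid, a $1$i-signed-group, and an abelian $1$i-signed-group.
   Context: **Magnitudes.** $P$ is a non-empty set with two binary operations $+$ and $\cdot$ such that: $(P,+)$ is a commutative monoid with identity $0$; $(P\setminus\{0\},\cdot)$ is an abelian group (its identity is written $1$); and $\cdot$ distributes over $+$ on both sides. Moreover $(P,+,\le)$ is a totally ordered (with translation-invariant order) cancellative commutative monoid, such that whenever $a\ge b$ there is a unique $c\in P$ with $b+c=a$, denoted $a-b$. Finally, $P$ has no nonzero additive inverses: if $a,b\in P$ and $a+b=0$ then $a=b=0$. The product $a\cdot b$ in $P$ is written $ab$. **Multisign set.** Fix an integer $s\ge 1$ and let $D=\{0,1,\dots,s\}$. The set $\Sigma^{s}$ consists of formal pairs ${}^{d}p$ with sign $d\in D$ and magnitude $p\in P$, where the sign $0$ is reserved for the element ${}^{0}0$, and ${}^{0}0$ is the only element with magnitude $0$. Thus $\Sigma^{s}=\{{}^{0}0\}\cup\{{}^{d}p: d\in\{1,\dots,s\},\ p\in P\setminus\{0\}\}$. **Multiplication.** For ${}^{i}a,{}^{j}b\in\Sigma^{s}$: $${}^{i}a\otimes{}^{j}b=\begin{cases}{}^{0}0&\text{if } {}^{i}a={}^{0}0\text{ or }{}^{j}b={}^{0}0,\\ {}^{\,i+j-1-s}(ab)&\text{if both are}\neq{}^{0}0\text{ and } i+j-1>s,\\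 {}^{\,i+j-1}(ab)&\text{if both are}\neq{}^{0}0\text{ and } i+j-1\le s.\end{cases}$$ **Structures.** Let $S$ be $\Sigma^s$ or $\Sigma^s\setminus\{{}^{0}0\}$, with a binary operation $\circledast$, and let $n\ge 0$ be an integer. - *Signed-associativity*: ${}^{i}a\circledast({}^{j}b\circledast{}^{k}c)=({}^{i}a\circledast{}^{j}b)\circledast{}^{k}c$ for all ${}^{i}a,{}^{j}b,{}^{k}c\in S$ whose signs satisfy $|\{i,j,k\}|\le 2$. - $(S,\circledast)$ is a *signed-semigroup* if $S$ is closed under $\circledast$ and signed-associativity holds; a *signed-monoid* if moreover there is ${}^{h}e\in S$ with ${}^{h}e\circledast x=x=x\circledast{}^{h}e$ for all $x\in S$. - $(S,\circledast)$ is an *$n$i-loop* if: $S$ is closed under $\circledast$; there is an identity ${}^{h}e\in S$; and for every $x\in S$ with $x\ne{}^{h}e$ there are exactly $n$ distinct $y\in S$ with $x\circledast y={}^{h}e=y\circledast x$, while ${}^{h}e$ is its own unique inverse. - An *$n$i-signed-group* is an $n$i-loop satisfying signed-associativity; it is *abelian* if $\circledast$ is commutative. *)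

theory Defs
  imports "HOL-Algebra.Multiplicative_Group"
begin

text \<open>
  Magnitudes. The nonzero magnitudes with multiplication form the structure \<open>mult_of P\<close>.
  The order is an explicit relation, of which only the restriction to the carrier matters.
  Closure of the product on all of \<open>P\<close> has to be required, as \<open>mult_of P\<close> says nothing
  about products with \<open>\<zero>\<close>.
\<close>

locale magnitudes = abelian_monoid P for P (structure) +
  fixes le :: "'a \<Rightarrow> 'a \<Rightarrow> bool" (infix \<open>\<preceq>\<close> 50)
  assumes mult_closed: "\<lbrakk>a \<in> carrier P; b \<in> carrier P\<rbrakk> \<Longrightarrow> a \<otimes> b \<in> carrier P"
    and nonzero_comm_group: "comm_group (mult_of P)"
    and distrib_left: "\<lbrakk>a \<in> carrier P; b \<in> carrier P; c \<in> carrier P\<rbrakk>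
      \<Longrightarrow> a \<otimes> (b \<oplus> c) = (a \<otimes> b) \<oplus> (a \<otimes> c)"
    and distrib_right: "\<lbrakk>a \<in> carrier P; b \<in> carrier P; c \<in> carrier P\<rbrakk>
      \<Longrightarrow> (b \<oplus> c) \<otimes> a = (b \<otimes> a) \<oplus> (c \<otimes> a)"
    and le_refl: "reflp_on (carrier P) (\<preceq>)"
    and le_antisym: "antisymp_on (carrier P) (\<preceq>)"
    and le_trans: "transp_on (carrier P) (\<preceq>)"
    and le_total: "totalp_on (carrier P) (\<preceq>)"
    and add_mono: "\<lbrakk>a \<in> carrier P; b \<in> carrier P; c \<in> carrier P; a \<preceq> b\<rbrakk>
      \<Longrightarrow> a \<oplus> c \<preceq> b \<oplus> c"
    and add_cancel: "\<lbrakk>a \<in> carrier P; b \<in> carrier P; c \<in> carrier P; a \<oplus> c = b \<oplus> c\<rbrakk>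
      \<Longrightarrow> a = b"
    and diff_ex1: "\<lbrakk>a \<in> carrier P; b \<in> carrier P; b \<preceq> a\<rbrakk>
      \<Longrightarrow> \<exists>!c. c \<in> carrier P \<and> b \<oplus> c = a"
    and add_eq_zero: "\<lbrakk>a \<in> carrier P; b \<in> carrier P; a \<oplus> b = \<zero>\<rbrakk>
      \<Longrightarrow> a = \<zero> \<and> b = \<zero>"

text \<open>A multisigned element with sign \<open>d\<close> and magnitude \<open>p\<close> is the pair \<open>(d, p)\<close>.\<close>

definition ms_zero :: "('a, 'm) ring_scheme \<Rightarrow> nat \<times> 'a"
  where "ms_zero P = (0, \<zero>\<^bsub>P\<^esub>)"

definition multisign :: "('a, 'm) ring_scheme \<Rightarrow> nat \<Rightarrow> (nat \<times> 'a) set"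
  where "multisign P s = {ms_zero P} \<union> {1..s} \<times> (carrier P - {\<zero>\<^bsub>P\<^esub>})"

text \<open>
  The subtractions on \<open>nat\<close> below are never truncated for elements of \<open>multisign P s\<close>,
  since nonzero elements have signs \<open>\<ge> 1\<close>.
\<close>

fun ms_mult :: "('a, 'm) ring_scheme \<Rightarrow> nat \<Rightarrow> nat \<times> 'a \<Rightarrow> nat \<times> 'a \<Rightarrow> nat \<times> 'a"
  where "ms_mult P s (i, a) (j, b) =
    (if (i, a) = ms_zero P \<or> (j, b) = ms_zero P then ms_zero P
     else if i + j - 1 > s then (i + j - 1 - s, a \<otimes>\<^bsub>P\<^esub> b)
     else (i + j - 1, a \<otimes>\<^bsub>P\<^esub> b))"

definition closed_under :: "'b set \<Rightarrow> ('b \<Rightarrow> 'b \<Rightarrow> 'b) \<Rightarrow> bool"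
  where "closed_under S f \<longleftrightarrow> (\<forall>x\<in>S. \<forall>y\<in>S. f x y \<in> S)"

definition is_identity :: "'b set \<Rightarrow> ('b \<Rightarrow> 'b \<Rightarrow> 'b) \<Rightarrow> 'b \<Rightarrow> bool"
  where "is_identity S f e \<longleftrightarrow> e \<in> S \<and> (\<forall>x\<in>S. f e x = x \<and> f x e = x)"

definition inverses :: "'b set \<Rightarrow> ('b \<Rightarrow> 'b \<Rightarrow> 'b) \<Rightarrow> 'b \<Rightarrow> 'b \<Rightarrow> 'b set"
  where "inverses S f e x = {y \<in> S. f x y = e \<and> f y x = e}"

definition signed_associative ::
    "(nat \<times> 'a) set \<Rightarrow> (nat \<times> 'a \<Rightarrow> nat \<times> 'a \<Rightarrow> nat \<times> 'a) \<Rightarrow> bool"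
  where "signed_associative S f \<longleftrightarrow>
    (\<forall>x\<in>S. \<forall>y\<in>S. \<forall>z\<in>S. card {fst x, fst y, fst z} \<le> 2 \<longrightarrow> f x (f y z) = f (f x y) z)"

definition signed_semigroup ::
    "(nat \<times> 'a) set \<Rightarrow> (nat \<times> 'a \<Rightarrow> nat \<times> 'a \<Rightarrow> nat \<times> 'a) \<Rightarrow> bool"
  where "signed_semigroup S f \<longleftrightarrow> closed_under S f \<and> signed_associative S f"

definition signed_monoid ::
    "(nat \<times> 'a) set \<Rightarrow> (nat \<times> 'a \<Rightarrow> nat \<times> 'a \<Rightarrow> nat \<times> 'a) \<Rightarrow> bool"
  where "signed_monoid S f \<longleftrightarrow> signed_semigroup S f \<and> (\<exists>e. is_identity S f e)"

text \<open>
  Finiteness is stated separately because infinite sets have \<open>card\<close> equal to \<open>0\<close>.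
\<close>

definition ni_loop ::
    "nat \<Rightarrow> (nat \<times> 'a) set \<Rightarrow> (nat \<times> 'a \<Rightarrow> nat \<times> 'a \<Rightarrow> nat \<times> 'a) \<Rightarrow> bool"
  where "ni_loop n S f \<longleftrightarrow> closed_under S f \<and>
    (\<exists>e. is_identity S f e \<and>
         (\<forall>x\<in>S. x \<noteq> e \<longrightarrow> finite (inverses S f e x) \<and> card (inverses S f e x) = n) \<and>
         inverses S f e e = {e})"

definition ni_signed_group ::
    "nat \<Rightarrow> (nat \<times> 'a) set \<Rightarrow> (nat \<times> 'a \<Rightarrow> nat \<times> 'a \<Rightarrow> nat \<times> 'a) \<Rightarrow> bool"
  where "ni_signed_group n S f \<longleftrightarrow> ni_loop n S f \<and> signed_associative S f"

definition abelian_ni_signed_group ::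
    "nat \<Rightarrow> (nat \<times> 'a) set \<Rightarrow> (nat \<times> 'a \<Rightarrow> nat \<times> 'a \<Rightarrow> nat \<times> 'a) \<Rightarrow> bool"
  where "abelian_ni_signed_group n S f \<longleftrightarrow>
    ni_signed_group n S f \<and> (\<forall>x\<in>S. \<forall>y\<in>S. f x y = f y x)"

end

theory Submission
  imports Defs
begin

text \<open>
  On nonzero elements the signs \<open>1, \<dots>, s\<close> multiply like a cyclic group of order \<open>s\<close> with
  identity \<open>1\<close>, so that the nonzero elements form the direct product of this cyclic group with
  the group of nonzero magnitudes. Associativity therefore holds for all triples, whatever their
  signs, and it survives adjoining an absorbing zero.
\<close>

definition ms_group :: "('a, 'm) ring_scheme \<Rightarrow> nat \<Rightarrow> (nat \<times> 'a) monoid"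
  where "ms_group P s =
    \<lparr>carrier = multisign P s - {ms_zero P}, mult = ms_mult P s, one = (1, \<one>\<^bsub>P\<^esub>)\<rparr>"

lemma nonzero_multisign:
  "multisign P s - {ms_zero P} = {1..s} \<times> carrier (mult_of P)"
  by (auto simp: multisign_def ms_zero_def)

lemma ms_zero_in_multisign: "ms_zero P \<in> multisign P s"
  by (simp add: multisign_def)

lemma ms_mult_zero [simp]:
  "ms_mult P s (ms_zero P) x = ms_zero P"
  "ms_mult P s x (ms_zero P) = ms_zero P"
  by (cases x; simp add: ms_zero_def)+

text \<open>The zero has sign 0, so signs that are at least 1 rule out the absorbing case. With the
  conditional moved into the first coordinate, signs and magnitudes multiply separately, as in a
  direct product.\<close>

lemma ms_mult_nonzero:
  assumes "i \<ge> 1" "j \<ge> 1"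
  shows "ms_mult P s (i, a) (j, b) =
    (if i + j - 1 > s then i + j - 1 - s else i + j - 1, a \<otimes>\<^bsub>P\<^esub> b)"
  using assms by (simp add: ms_zero_def)

text \<open>The shift from \<open>i\<close> to \<open>i - 1\<close> turns the sign rule into
  addition modulo \<open>s\<close>. A single subtraction of \<open>s\<close> suffices, because
  \<open>i + j - 1\<close> is at most \<open>2 * s - 1\<close>.\<close>

lemma comm_group_ms_group:
  fixes P :: "('a, 'm) ring_scheme"
  assumes "comm_group (mult_of P)" and "s \<ge> 1"
  shows "comm_group (ms_group P s)"
proof -
  interpret M: comm_group "mult_of P" by fact
  \<comment> \<open>With \<open>carrier (mult_of P)\<close> kept folded the facts of
    \<open>M\<close> match, and products are rewritten by \<open>ms_mult_nonzero\<close> instead of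
    the defining case split.\<close>
  note [simp del] = carrier_mult_of ms_mult.simps
  have car: "carrier (ms_group P s) = {1..s} \<times> carrier (mult_of P)"
    by (simp add: ms_group_def nonzero_multisign)
  have mult: "x \<otimes>\<^bsub>ms_group P s\<^esub> y = ms_mult P s x y" for x y
    by (simp add: ms_group_def)
  have one: "\<one>\<^bsub>ms_group P s\<^esub> = (1, \<one>\<^bsub>P\<^esub>)"
    by (simp add: ms_group_def)
  note closed = M.m_closed[simplified]
  show ?thesis
  proof (rule comm_groupI)
    fix x y
    assume "x \<in> carrier (ms_group P s)" and "y \<in> carrier (ms_group P s)"
    then show "x \<otimes>\<^bsub>ms_group P s\<^esub> y \<in> carrier (ms_group P s)"
      by (auto simp: car mult ms_mult_nonzero closed)
  next
    show "\<one>\<^bsub>ms_group P s\<^esub> \<in> carrier (ms_group P s)"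
      using M.one_closed \<open>s \<ge> 1\<close> by (simp add: car one)
  next
    fix x y z
    assume "x \<in> carrier (ms_group P s)" and "y \<in> carrier (ms_group P s)"
      and "z \<in> carrier (ms_group P s)"
    \<comment> \<open>If \<open>i\<close>, \<open>j\<close>, \<open>k\<close> are the signs of the
      factors, both bracketings have a sign in \<open>{1..s}\<close> congruent to
      \<open>i + j + k - 2\<close> modulo \<open>s\<close>, so the two signs agree.\<close>
    then show "x \<otimes>\<^bsub>ms_group P s\<^esub> y \<otimes>\<^bsub>ms_group P s\<^esub> z
        = x \<otimes>\<^bsub>ms_group P s\<^esub> (y \<otimes>\<^bsub>ms_group P s\<^esub> z)"
      using M.m_assoc by (auto simp: car mult ms_mult_nonzero add.assoc)
  next
    fix x y
    assume "x \<in> carrier (ms_group P s)" and "y \<in> carrier (ms_group P s)"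
    then show "x \<otimes>\<^bsub>ms_group P s\<^esub> y = y \<otimes>\<^bsub>ms_group P s\<^esub> x"
      using M.m_comm by (auto simp: car mult ms_mult_nonzero add.commute)
  next
    fix x
    assume "x \<in> carrier (ms_group P s)"
    then show "\<one>\<^bsub>ms_group P s\<^esub> \<otimes>\<^bsub>ms_group P s\<^esub> x = x"
      using M.l_one by (auto simp: car mult one ms_mult_nonzero)
  next
    fix x
    assume "x \<in> carrier (ms_group P s)"
    then obtain i a where x: "x = (i, a)" and i: "i \<in> {1..s}" and a: "a \<in> carrier (mult_of P)"
      by (auto simp: car)
    obtain b where b: "b \<in> carrier (mult_of P)" "b \<otimes>\<^bsub>P\<^esub> a = \<one>\<^bsub>P\<^esub>"
      using M.l_inv_ex[OF a] by auto
    \<comment> \<open>The inverse sign solves \<open>i + j - 1 = s + 1\<close>, which wraps around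
      to 1. For \<open>i = 1\<close> this solution would be \<open>s + 1\<close>, outside the range,
      and 1 is its own inverse.\<close>
    define j where "j = (if i = 1 then 1 else s + 2 - i)"
    have "j \<in> {1..s}" using i by (auto simp: j_def)
    then have "(j, b) \<in> carrier (ms_group P s)" using b(1) by (simp add: car)
    moreover have "(j, b) \<otimes>\<^bsub>ms_group P s\<^esub> x = \<one>\<^bsub>ms_group P s\<^esub>"
      using i \<open>j \<in> {1..s}\<close> b(2) by (auto simp: x mult one ms_mult_nonzero j_def)
    ultimately show "\<exists>y\<in>carrier (ms_group P s).
        y \<otimes>\<^bsub>ms_group P s\<^esub> x = \<one>\<^bsub>ms_group P s\<^esub>"
      by blast
  qed
qed

text \<open>A one-sided inverse in a group is already the inverse. The singleton serves both inverse
  clauses of \<open>ni_loop 1\<close>, the one at the identity through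
  \<open>inv \<one> = \<one>\<close>.\<close>

lemma (in group) inverses_eq:
  assumes "x \<in> carrier G"
  shows "inverses (carrier G) (mult G) \<one> x = {inv x}"
  using assms by (auto simp: inverses_def inv_equality)

lemma (in monoid) is_identity_one: "is_identity (carrier G) (mult G) \<one>"
  by (simp add: is_identity_def)

lemma comm_group_abelian_1i_signed_group:
  fixes G :: "(nat \<times> 'a) monoid" (structure)
  assumes "comm_group G"
  shows "abelian_ni_signed_group 1 (carrier G) (mult G)"
proof -
  interpret comm_group G by fact
  have "ni_loop 1 (carrier G) (mult G)"
    unfolding ni_loop_def using is_identity_one inverses_eq
    by (intro conjI exI[of _ \<one>]) (simp_all add: closed_under_def)
  then show ?thesis
    by (simp add: abelian_ni_signed_group_def ni_signed_group_def signed_associative_def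
        m_ac)
qed

lemma abelian_ni_signed_group_signed_monoid:
  assumes "abelian_ni_signed_group n S f"
  shows "signed_monoid S f"
  using assms
  by (auto simp: abelian_ni_signed_group_def ni_signed_group_def ni_loop_def
      signed_monoid_def signed_semigroup_def)

lemma signed_monoid_adjoin_zero:
  assumes "signed_monoid (multisign P s - {ms_zero P}) (ms_mult P s)"
  shows "signed_monoid (multisign P s) (ms_mult P s)"
proof -
  let ?Z = "ms_zero P" and ?f = "ms_mult P s"
  let ?N = "multisign P s - {?Z}"
  \<comment> \<open>As a rewrite rule this equation would loop, since \<open>?N\<close> contains its
    left-hand side. The claims are therefore proved for \<open>insert ?Z ?N\<close> and transferred
    at the end.\<close>
  have N: "multisign P s = insert ?Z ?N"
    using ms_zero_in_multisign by blast
  from assms obtain e where closed: "closed_under ?N ?f"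
    and assoc: "signed_associative ?N ?f" and e: "is_identity ?N ?f e"
    by (auto simp: signed_monoid_def signed_semigroup_def)
  have "closed_under (insert ?Z ?N) ?f"
    using closed unfolding closed_under_def by (metis insert_iff ms_mult_zero)
  moreover have "signed_associative (insert ?Z ?N) ?f"
    unfolding signed_associative_def
  proof (intro ballI impI)
    fix x y z
    assume "x \<in> insert ?Z ?N" "y \<in> insert ?Z ?N" "z \<in> insert ?Z ?N"
      and "card {fst x, fst y, fst z} \<le> 2"
    \<comment> \<open>With a zero among the factors both bracketings collapse to zero; otherwise all
      three lie in \<open>?N\<close>.\<close>
    then show "?f x (?f y z) = ?f (?f x y) z"
      using assoc unfolding signed_associative_def
      by (cases "x = ?Z \<or> y = ?Z \<or> z = ?Z") (auto simp del: ms_mult.simps)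
  qed
  \<comment> \<open>The old identity also fixes the new element, because zero absorbs it.\<close>
  moreover have "is_identity (insert ?Z ?N) ?f e"
    using e by (auto simp: is_identity_def simp del: ms_mult.simps)
  ultimately show ?thesis
    unfolding signed_monoid_def signed_semigroup_def by (metis N)
qed

theorem theorem3p23:
  fixes P :: "('a, 'm) ring_scheme" and le :: "'a \<Rightarrow> 'a \<Rightarrow> bool" and s :: nat
  assumes "magnitudes P le"
    and "s \<ge> 1"
  shows "signed_semigroup (multisign P s) (ms_mult P s)
    \<and> signed_monoid (multisign P s) (ms_mult P s)
    \<and> ni_loop 1 (multisign P s - {ms_zero P}) (ms_mult P s)
    \<and> signed_semigroup (multisign P s - {ms_zero P}) (ms_mult P s)
    \<and> signed_monoid (multisign P s - {ms_zero P}) (ms_mult P s)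
    \<and> ni_signed_group 1 (multisign P s - {ms_zero P}) (ms_mult P s)
    \<and> abelian_ni_signed_group 1 (multisign P s - {ms_zero P}) (ms_mult P s)"
proof -
  have "comm_group (ms_group P s)"
    using comm_group_ms_group magnitudes.nonzero_comm_group assms by blast
  then have group: "abelian_ni_signed_group 1 (multisign P s - {ms_zero P}) (ms_mult P s)"
    using comm_group_abelian_1i_signed_group[of "ms_group P s"] by (simp add: ms_group_def)
  then have nonzero: "signed_monoid (multisign P s - {ms_zero P}) (ms_mult P s)"
    by (rule abelian_ni_signed_group_signed_monoid)
  then have "signed_monoid (multisign P s) (ms_mult P s)"
    by (rule signed_monoid_adjoin_zero)
  with group nonzero show ?thesis
    by (auto simp: signed_monoid_def abelian_ni_signed_group_def ni_signed_group_def)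
qed

end
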